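(* Let $f:\mathbb{R}^n\to\mathbb{R}^m$ be a non-constant polynomial map and denote $S:=f(\mathbb{R}^n)$. Then the set $S_\infty$ of points at infinity of $S$ is non-empty and connected.
   Context: A map $f=(f_1,\ldots,f_m):\mathbb{R}^n\to\mathbb{R}^m$ is a polynomial map if each component $f_i$ belongs to $\mathbb{R}[x_1,\ldots,x_n]$. The real projective space $\mathbb{R}\mathbb{P}^m$, with homogeneous coordinates $(x_0:x_1:\cdots:x_m)$, contains $\mathbb{R}^m$ as the set of points with $x_0=1$, i.e. $(y_1,\ldots,y_m)$ is identified with $(1:y_1:\cdots:y_m)$. The hyperplane at infinity is $\mathsf{H}_\infty:=\{x_0=0\}\subset\mathbb{R}\mathbb{P}^m$. For a semialgebraic set $S\subset\mathbb{R}^m$, the set of points at infinity of $S$ is $S_\infty:=\mathrm{Cl}_{\mathbb{R}\mathbb{P}^m}(S)\cap\mathsf{H}_\infty$, where $\mathrm{Cl}_{\mathbb{R}\mathbb{P}^m}$ denotes closure in $\mathbb{R}\mathbb{P}^m$ (Euclidean topology). The image of a polynomial map is semialgebraic by the Tarski-Seidenberg theorem. *)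

theory Defs
  imports "HOL-Analysis.Analysis"
begin

text \<open>
  Componentwise definition; \<^const>\<open>real_polynomial_function\<close> is the library's predicate for the
  functions on a Euclidean space that are given by a polynomial in the coordinates.
\<close>

definition polynomial_map :: "(real ^ 'n \<Rightarrow> real ^ 'm) \<Rightarrow> bool" where
  "polynomial_map f \<longleftrightarrow> (\<forall>i. real_polynomial_function (\<lambda>x. f x $ i))"

text \<open>
  Real projective space of dimension \<open>CARD('m)\<close>. The pair \<open>(x\<^sub>0, x)\<close> represents the homogeneous
  coordinates \<open>x\<^sub>0 : x\<^sub>1 : \<dots> : x\<^sub>m\<close>; the zero vector lies outside the domain of the partial
  equivalence relation, so it represents no point.
\<close>

definition proportional :: "real \<times> (real ^ 'm) \<Rightarrow> real \<times> (real ^ 'm) \<Rightarrow> bool" where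
  "proportional u v \<longleftrightarrow> u \<noteq> 0 \<and> v \<noteq> 0 \<and> (\<exists>c. c \<noteq> 0 \<and> v = c *\<^sub>R u)"

lemma part_equivp_proportional: "part_equivp (proportional :: real \<times> (real ^ 'm) \<Rightarrow> _)"
proof (rule part_equivpI)
  have "proportional (1, 0 :: real ^ 'm) (1, 0)"
    unfolding proportional_def by (auto simp: zero_prod_def intro!: exI[of _ 1])
  then show "\<exists>u :: real \<times> (real ^ 'm). proportional u u" ..
  show "symp (proportional :: real \<times> (real ^ 'm) \<Rightarrow> _)"
  proof (rule sympI)
    fix u v :: "real \<times> (real ^ 'm)"
    assume "proportional u v"
    then obtain c where c: "u \<noteq> 0" "v \<noteq> 0" "c \<noteq> 0" "v = c *\<^sub>R u"
      unfolding proportional_def by blast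
    then have "u = inverse c *\<^sub>R v" by simp
    with c show "proportional v u"
      unfolding proportional_def by (metis nonzero_imp_inverse_nonzero)
  qed
  show "transp (proportional :: real \<times> (real ^ 'm) \<Rightarrow> _)"
  proof (rule transpI)
    fix u v w :: "real \<times> (real ^ 'm)"
    assume "proportional u v" "proportional v w"
    then show "proportional u w"
      unfolding proportional_def by (metis mult_eq_0_iff scaleR_scaleR)
  qed
qed

quotient_type 'm real_proj = "real \<times> (real ^ 'm)" / partial: proportional
  morphisms rep_real_proj hom_coords
  by (rule part_equivp_proportional)

lemma hom_coords_eq_iff:
  assumes "u \<noteq> 0" "v \<noteq> 0"
  shows "hom_coords u = hom_coords v \<longleftrightarrow> (\<exists>c. c \<noteq> 0 \<and> v = c *\<^sub>R u)"
proof -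
  have "proportional u u" "proportional v v"
    using assms by (auto simp: proportional_def intro!: exI[of _ 1])
  then show ?thesis
    using Quotient3_rel[OF Quotient3_real_proj, of u v] assms unfolding proportional_def by simp
qed

text \<open>The quotient topology of the Euclidean topology on the nonzero vectors.\<close>

instantiation real_proj :: (finite) topological_space
begin

definition open_real_proj :: "'a real_proj set \<Rightarrow> bool" where
  "open_real_proj U \<longleftrightarrow> open {v. v \<noteq> 0 \<and> hom_coords v \<in> U}"

instance
proof
  have "{v :: real \<times> (real ^ 'a). v \<noteq> 0 \<and> hom_coords v \<in> UNIV} = - {0}" by auto
  then show "open (UNIV :: 'a real_proj set)"
    unfolding open_real_proj_def by (metis open_Compl closed_singleton)
next
  fix S T :: "'a real_proj set"
  assume "open S" "open T"
  then have "open ({v. v \<noteq> 0 \<and> hom_coords v \<in> S} \<inter> {v. v \<noteq> 0 \<and> hom_coords v \<in> T})"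
    unfolding open_real_proj_def by (rule open_Int)
  also have "{v. v \<noteq> 0 \<and> hom_coords v \<in> S} \<inter> {v. v \<noteq> 0 \<and> hom_coords v \<in> T}
      = {v. v \<noteq> 0 \<and> hom_coords v \<in> S \<inter> T}" by auto
  finally show "open (S \<inter> T)" unfolding open_real_proj_def .
next
  fix K :: "'a real_proj set set"
  assume "\<forall>S\<in>K. open S"
  then have "open (\<Union>S\<in>K. {v. v \<noteq> 0 \<and> hom_coords v \<in> S})"
    unfolding open_real_proj_def by (intro open_UN)
  also have "(\<Union>S\<in>K. {v. v \<noteq> 0 \<and> hom_coords v \<in> S}) = {v. v \<noteq> 0 \<and> hom_coords v \<in> \<Union>K}"
    by auto
  finally show "open (\<Union>K)" unfolding open_real_proj_def .
qed

end

definition affine_embed :: "real ^ 'm \<Rightarrow> 'm real_proj" where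
  "affine_embed y = hom_coords (1, y)"

definition hyperplane_at_infinity :: "('m :: finite) real_proj set" where
  "hyperplane_at_infinity = {hom_coords (0, y) | y. y \<noteq> 0}"

definition points_at_infinity :: "(real ^ 'm) set \<Rightarrow> 'm real_proj set" where
  "points_at_infinity S = closure (affine_embed ` S) \<inter> hyperplane_at_infinity"

end

theory Submission imports Defs "HOL-Computational_Algebra.Polynomial" begin

text \<open>
  Suppose the points at infinity split into two disjoint nonempty closed sets, with closed cones
  \<open>A\<close> and \<open>B\<close> over them. Take points \<open>x\<^sub>k\<close>, \<open>y\<^sub>k\<close> along which \<open>f\<close> tends to infinity in a direction of \<open>A\<close>
  and of \<open>B\<close>, respectively, and consider on the line through them the probes with centre \<open>t\<close> and radius
  \<open>t(1 - t)\<close>, where \<open>t = 0\<close> is \<open>x\<^sub>k\<close> and \<open>t = 1\<close> is \<open>y\<^sub>k\<close>. Restricted to such a probe and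
  rescaled to the parameter \<open>\<tau>\<close>, \<open>f\<close> is a polynomial of bounded degree whose
  coefficients are large, since its value at one of the endpoints is a value at a bounded \<open>\<tau>\<close>.
  Comparing the distances to \<open>A\<close> and \<open>B\<close> at the sample points \<open>\<tau> = 0, \<dots>, d\<close>, the probes move from \<open>A\<close> to \<open>B\<close>
  as \<open>t\<close> runs from 0 to 1, so some probe is balanced. After normalization the balanced
  probes subconverge to a nonzero polynomial curve with values in \<open>A \<union> B\<close>. But
  the direction of a nonzero polynomial curve extends continuously across its zeros, so the curve
  lies in \<open>A\<close> or in \<open>B\<close> alone and is not balanced.
\<close>

section \<open>Restriction of polynomial maps to lines, with a uniform degree bound\<close>

lemma real_polynomial_function_on_line:
  assumes "real_polynomial_function p"
  shows "\<exists>d. \<forall>x v. \<exists>q. degree q \<le> d \<and> (\<forall>t. p (x + t *\<^sub>R v) = poly q t)"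
  using assms
proof induction
  case (linear p)
  then interpret bounded_linear p .
  have "degree [:p x, p v:] \<le> 1 \<and> (\<forall>t. p (x + t *\<^sub>R v) = poly [:p x, p v:] t)" for x v
    by (auto simp: add scaleR)
  then show ?case by blast
next
  case (const c)
  have "degree [:c:] \<le> 0 \<and> (\<forall>t. c = poly [:c:] t)"
    by simp
  then show ?case by blast
next
  case (add p q)
  then obtain d e P Q where
    "\<And>x v. degree (P x v) \<le> d" "\<And>x v t. p (x + t *\<^sub>R v) = poly (P x v) t"
    "\<And>x v. degree (Q x v) \<le> e" "\<And>x v t. q (x + t *\<^sub>R v) = poly (Q x v) t"
    by metis
  then have "degree (P x v + Q x v) \<le> max d e \<and>
      (\<forall>t. p (x + t *\<^sub>R v) + q (x + t *\<^sub>R v) = poly (P x v + Q x v) t)" for x v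
    by (simp add: degree_add_le max.coboundedI1 max.coboundedI2)
  then show ?case by blast
next
  case (mult p q)
  then obtain d e P Q where
    "\<And>x v. degree (P x v) \<le> d" "\<And>x v t. p (x + t *\<^sub>R v) = poly (P x v) t"
    "\<And>x v. degree (Q x v) \<le> e" "\<And>x v t. q (x + t *\<^sub>R v) = poly (Q x v) t"
    by metis
  then have "degree (P x v * Q x v) \<le> d + e \<and>
      (\<forall>t. p (x + t *\<^sub>R v) * q (x + t *\<^sub>R v) = poly (P x v * Q x v) t)" for x v
    by (auto intro!: order_trans[OF degree_mult_le] add_mono)
  then show ?case by blast
qed

text \<open>The order of quantifiers is the point: a single \<open>d\<close> serves all lines, while
  only the coefficients depend on the line. This makes it possible to sample every probe at the same
  \<open>d + 1\<close> parameters and to pass to limits of coefficients.\<close>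

lemma polynomial_map_on_line:
  fixes f :: "real ^ 'n \<Rightarrow> real ^ 'm"
  assumes "polynomial_map f"
  obtains d where "\<And>x v. \<exists>c. \<forall>t. f (x + t *\<^sub>R v) = (\<Sum>j\<le>d. t ^ j *\<^sub>R c j)"
proof -
  have "\<forall>i. \<exists>d. \<forall>x v. \<exists>q. degree q \<le> d \<and> (\<forall>t. f (x + t *\<^sub>R v) $ i = poly q t)"
    using assms real_polynomial_function_on_line unfolding polynomial_map_def by blast
  then obtain D Q where Q: "\<And>i x v. degree (Q i x v) \<le> D i"
      "\<And>i x v t. f (x + t *\<^sub>R v) $ i = poly (Q i x v) t"
    by metis
  \<comment> \<open>There are finitely many components, so their degree bounds have a
    maximum.\<close>
  define d where "d = Max (range D)"
  have d: "degree (Q i x v) \<le> d" for i x v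
    using Q(1)[of i x v] unfolding d_def by (meson Max_ge finite finite_imageI order_trans rangeI)
  have rep: "f (x + t *\<^sub>R v) = (\<Sum>j\<le>d. t ^ j *\<^sub>R (\<chi> i. coeff (Q i x v) j))" for x v t
  proof -
    have "poly (Q i x v) t = (\<Sum>j\<le>d. coeff (Q i x v) j * t ^ j)" for i
      unfolding poly_altdef using d[of i x v]
      by (intro sum.mono_neutral_left) (auto simp: coeff_eq_0)
    then show ?thesis
      by (simp add: vec_eq_iff Q mult.commute)
  qed
  show thesis
    by (rule that[of d], intro exI allI, rule rep)
qed

section \<open>Vector-valued polynomial curves and closed cones\<close>

lemma vector_polynomial_root_bound:
  fixes c :: "nat \<Rightarrow> 'b::euclidean_space"
  assumes "\<exists>j\<le>d. c j \<noteq> 0"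
  shows "finite {t::real. (\<Sum>j\<le>d. t ^ j *\<^sub>R c j) = 0} \<and> card {t::real. (\<Sum>j\<le>d. t ^ j *\<^sub>R c j) = 0} \<le> d"
proof -
  \<comment> \<open>Pairing with \<open>b\<close> yields a nonzero scalar polynomial that vanishes
    wherever the curve does.\<close>
  obtain j b where b: "j \<le> d" "c j \<bullet> b \<noteq> 0"
    using assms by (metis inner_eq_zero_iff)
  let ?Z = "{t::real. (\<Sum>j\<le>d. (c j \<bullet> b) * t ^ j) = 0}"
  have sub: "{t::real. (\<Sum>j\<le>d. t ^ j *\<^sub>R c j) = 0} \<subseteq> ?Z"
  proof clarify
    fix t :: real assume "(\<Sum>j\<le>d. t ^ j *\<^sub>R c j) = 0"
    then have "(\<Sum>j\<le>d. t ^ j *\<^sub>R c j) \<bullet> b = 0" by simp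
    then show "(\<Sum>j\<le>d. (c j \<bullet> b) * t ^ j) = 0" by (simp add: inner_sum_left mult.commute)
  qed
  have "finite ?Z" "card ?Z \<le> d"
    using polyfun_rootbound[of d "\<lambda>j. c j \<bullet> b"] b by auto
  then show ?thesis
    using sub by (meson card_mono finite_subset order_trans)
qed

text \<open>The root \<open>t0\<close> is divided out until it is gone; the induction on
  \<open>d\<close> terminates because the curve is nonzero at \<open>s\<close>. The vector
  \<open>H t0\<close> then gives the direction of the curve at \<open>t0\<close>, even if the curve
  vanishes there.\<close>

lemma vector_polynomial_factor:
  fixes c :: "nat \<Rightarrow> 'b::euclidean_space" and t0 :: real
  assumes "(\<Sum>j\<le>d. s ^ j *\<^sub>R c j) \<noteq> 0"
  shows "\<exists>m H. continuous_on UNIV H \<and> H t0 \<noteq> 0 \<and>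
    (\<forall>t. (\<Sum>j\<le>d. t ^ j *\<^sub>R c j) = (t - t0) ^ m *\<^sub>R H t)"
  using assms
proof (induction d arbitrary: c)
  case 0
  then show ?case
    by (intro exI[of _ 0] exI[of _ "\<lambda>_. c 0"]) auto
next
  case (Suc d)
  let ?g = "\<lambda>t. (\<Sum>j\<le>Suc d. t ^ j *\<^sub>R c j)"
  show ?case
  proof (cases "?g t0 = 0")
    case False
    then show ?thesis
      by (intro exI[of _ 0] exI[of _ ?g]) (auto intro!: continuous_intros simp del: sum.atMost_Suc)
  next
    case True
    \<comment> \<open>These are the coefficients of the quotient of \<open>?g t - ?g t0\<close> by
      \<open>t - t0\<close>.\<close>
    define e where "e j = (\<Sum>k=Suc j..Suc d. t0 ^ (k - Suc j) *\<^sub>R c k)" for j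
    have g: "?g t = (t - t0) *\<^sub>R (\<Sum>j\<le>d. t ^ j *\<^sub>R e j)" for t
    proof (rule euclidean_eqI)
      fix b :: 'b
      have "?g t \<bullet> b = ?g t \<bullet> b - ?g t0 \<bullet> b"
        using True by simp
      also have "\<dots> = (\<Sum>j\<le>Suc d. (c j \<bullet> b) * t ^ j) - (\<Sum>j\<le>Suc d. (c j \<bullet> b) * t0 ^ j)"
        by (simp add: inner_sum_left mult.commute del: sum.atMost_Suc)
      also have "\<dots> = (t - t0) * (\<Sum>j\<le>d. \<Sum>k=Suc j..Suc d. (c k \<bullet> b) * t0 ^ (k - Suc j) * t ^ j)"
        by (subst sub_polyfun) (simp add: lessThan_Suc_atMost del: sum.atMost_Suc)
      also have "\<dots> = ((t - t0) *\<^sub>R (\<Sum>j\<le>d. t ^ j *\<^sub>R e j)) \<bullet> b"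
        by (simp add: inner_sum_left e_def sum_distrib_left mult_ac
            del: sum.atMost_Suc sum.cl_ivl_Suc)
      finally show "?g t \<bullet> b = ((t - t0) *\<^sub>R (\<Sum>j\<le>d. t ^ j *\<^sub>R e j)) \<bullet> b" .
    qed
    with Suc.prems have "(\<Sum>j\<le>d. s ^ j *\<^sub>R e j) \<noteq> 0"
      by (metis scaleR_zero_right)
    from Suc.IH[OF this] obtain m H where H: "continuous_on UNIV H" "H t0 \<noteq> 0"
      "\<And>t. (\<Sum>j\<le>d. t ^ j *\<^sub>R e j) = (t - t0) ^ m *\<^sub>R H t" by blast
    then have "?g t = (t - t0) ^ Suc m *\<^sub>R H t" for t
      unfolding g by simp
    with H show ?thesis by blast
  qed
qed

text \<open>Near \<open>t0\<close> the curve is \<open>(t - t0) ^ m *\<^sub>R H t\<close> with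
  \<open>H t0\<close> nonzero. The cones are stable under all real scalars, negative ones included,
  so a change of sign of the factor is harmless and the cone containing \<open>H t0\<close> decides
  where the curve lies on both sides of \<open>t0\<close>.\<close>

lemma polynomial_curve_in_one_cone:
  fixes c :: "nat \<Rightarrow> 'b::euclidean_space"
  assumes "closed A" "closed B"
    and coneA: "\<And>s w. w \<in> A \<Longrightarrow> s *\<^sub>R w \<in> A" and coneB: "\<And>s w. w \<in> B \<Longrightarrow> s *\<^sub>R w \<in> B"
    and AB: "A \<inter> B = {0}" and nz: "\<exists>j\<le>d. c j \<noteq> 0"
    and mem: "\<And>t::real. (\<Sum>j\<le>d. t ^ j *\<^sub>R c j) \<in> A \<union> B"
  shows "(\<forall>t::real. (\<Sum>j\<le>d. t ^ j *\<^sub>R c j) \<in> A) \<or> (\<forall>t::real. (\<Sum>j\<le>d. t ^ j *\<^sub>R c j) \<in> B)"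
proof -
  define g :: "real \<Rightarrow> 'b" where "g t = (\<Sum>j\<le>d. t ^ j *\<^sub>R c j)" for t
  have fin: "finite {t. g t = 0}"
    using vector_polynomial_root_bound[OF nz] unfolding g_def by blast
  then obtain s where s: "g s \<noteq> 0"
    by (metis (mono_tags, lifting) UNIV_eq_I infinite_UNIV_char_0 mem_Collect_eq)
  have cont: "continuous_on UNIV g"
    unfolding g_def by (intro continuous_intros)
  \<comment> \<open>The cones are renamed so that the claim can be used with either one as
    \<open>A'\<close>. Near \<open>t0\<close> the factor \<open>H\<close> avoids the closed set
    \<open>B'\<close>; dividing by the power of \<open>t - t0\<close> shows that the curve avoids it
    too, except possibly at \<open>t0\<close>.\<close>
  have local: "\<exists>U. open U \<and> t0 \<in> U \<and> g ` U \<subseteq> A'"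
    if B': "closed B'" and coneA': "\<And>s w. w \<in> A' \<Longrightarrow> s *\<^sub>R w \<in> A'"
      and coneB': "\<And>s w. w \<in> B' \<Longrightarrow> s *\<^sub>R w \<in> B'"
      and AB': "A' \<union> B' = A \<union> B" "A' \<inter> B' = {0}"
      and H: "continuous_on UNIV H" "H t0 \<noteq> 0" "H t0 \<in> A'"
      and g: "\<And>t. g t = (t - t0) ^ m *\<^sub>R H t" for A' B' H t0 m
  proof -
    have "open (H -` (- B'))"
      using B' H(1) by (intro open_vimage) (auto simp: open_Compl)
    moreover have "t0 \<in> H -` (- B')"
      using H AB' by auto
    moreover have "g t \<in> A'" if t: "t \<in> H -` (- B')" for t
    proof (cases "t = t0")
      case True
      then show ?thesis
        using H(3) coneA' by (simp add: g)
    next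
      case False
      have "g t \<notin> B'"
      proof
        assume "g t \<in> B'"
        then have "inverse ((t - t0) ^ m) *\<^sub>R g t \<in> B'"
          by (rule coneB')
        then show False
          using t False by (simp add: g)
      qed
      then show ?thesis
        using mem[of t] AB'(1) unfolding g_def by blast
    qed
    ultimately show ?thesis by blast
  qed
  have cover: "t0 \<in> interior (g -` A) \<union> interior (g -` B)" for t0
  proof -
    obtain m H where H: "continuous_on UNIV H" "H t0 \<noteq> 0" "\<And>t. g t = (t - t0) ^ m *\<^sub>R H t"
      using vector_polynomial_factor[where d = d and s = s and c = c and ?t0.0 = t0] s unfolding g_def by blast
    have "H t \<in> A \<union> B" if "t \<noteq> t0" for t
    proof -
      have "H t = inverse ((t - t0) ^ m) *\<^sub>R g t"
        using that by (simp add: H)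
      then show ?thesis
        using mem[of t] coneA coneB unfolding g_def by auto
    qed
    \<comment> \<open>The hypothesis \<open>mem\<close> says nothing about \<open>H t0\<close>
      itself if the curve vanishes at \<open>t0\<close>, so \<open>H t0\<close> is reached as a
      limit of points of the closed set \<open>A \<union> B\<close>.\<close>
    then have "\<forall>\<^sub>F t in at t0. H t \<in> A \<union> B"
      by (simp add: eventually_at_filter)
    moreover have "(H \<longlongrightarrow> H t0) (at t0)"
      using H(1) by (simp add: continuous_on_def)
    ultimately have "H t0 \<in> A \<union> B"
      by (intro Lim_in_closed_set[of "A \<union> B" H "at t0"]) (use assms in auto)
    then consider "H t0 \<in> A" | "H t0 \<in> B" by blast
    then show ?thesis
    proof cases
      case 1
      have "\<exists>U. open U \<and> t0 \<in> U \<and> g ` U \<subseteq> A"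
        by (rule local[where A' = A and B' = B and H = H]) (use assms H 1 in auto)
      then show ?thesis
        by (metis UnI1 UnI2 image_subset_iff_subset_vimage interiorI)
    next
      case 2
      have "\<exists>U. open U \<and> t0 \<in> U \<and> g ` U \<subseteq> B"
        by (rule local[where A' = B and B' = A and H = H]) (use assms H 2 in auto)
      then show ?thesis
        by (metis UnI1 UnI2 image_subset_iff_subset_vimage interiorI)
    qed
  qed
  \<comment> \<open>The overlap is open and contained in the finite zero set, hence empty.
    Connectedness of the real line then leaves only one of the two open sets.\<close>
  have "interior (g -` A) \<inter> interior (g -` B) \<subseteq> {t. g t = 0}"
    using interior_subset AB by fastforce
  then have "finite (interior (g -` A) \<inter> interior (g -` B))"
    using fin finite_subset by blast
  then have "interior (g -` A) \<inter> interior (g -` B) = {}"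
    by (intro finite_imp_not_open) (auto intro: open_Int)
  then have "interior (g -` A) = UNIV \<or> interior (g -` B) = UNIV"
    using cover connectedD[OF connected_UNIV, of "interior (g -` A)" "interior (g -` B)"] by auto
  then show ?thesis
    using interior_subset unfolding g_def by blast
qed

section \<open>Balanced probes and the limiting curve\<close>

lemma finite_family_convergent_subsequence:
  fixes c :: "nat \<Rightarrow> nat \<Rightarrow> 'b::heine_borel"
  assumes "\<And>j. j < n \<Longrightarrow> bounded (range (\<lambda>k. c k j))"
  shows "\<exists>r L. strict_mono (r :: nat \<Rightarrow> nat) \<and> (\<forall>j<n. (\<lambda>k. c (r k) j) \<longlonglongrightarrow> L j)"
  using assms
proof (induction n)
  case 0
  have "strict_mono (\<lambda>k::nat. k)" by (simp add: strict_mono_def)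
  then show ?case by blast
next
  case (Suc n)
  then obtain r L where r: "strict_mono r" "\<And>j. j < n \<Longrightarrow> (\<lambda>k. c (r k) j) \<longlonglongrightarrow> L j"
    by (metis less_SucI)
  have "bounded (range (\<lambda>k. c (r k) n))"
    by (rule bounded_subset[OF Suc.prems[of n]]) auto
  then obtain l r' where r': "strict_mono (r' :: nat \<Rightarrow> nat)" "(\<lambda>k. c (r (r' k)) n) \<longlonglongrightarrow> l"
    using bounded_imp_convergent_subsequence[of "\<lambda>k. c (r k) n"] by (auto simp: o_def)
  have "(\<lambda>k. c (r (r' k)) j) \<longlonglongrightarrow> (L(n := l)) j" if "j < Suc n" for j
  proof (cases "j = n")
    case False
    then show ?thesis
      using LIMSEQ_subseq_LIMSEQ[OF r(2)[of j] r'(1)] that by (simp add: o_def)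
  qed (use r' in simp)
  moreover have "strict_mono (r \<circ> r')"
    using r r' by (simp add: strict_mono_o)
  ultimately show ?case
    by (intro exI[of _ "r \<circ> r'"] exI[of _ "L(n := l)"]) (simp add: o_def)
qed

lemma infdist_cone:
  fixes A :: "'b::real_normed_vector set"
  assumes "\<And>s w. w \<in> A \<Longrightarrow> s *\<^sub>R w \<in> A" "A \<noteq> {}"
  shows "infdist (s *\<^sub>R w) A = \<bar>s\<bar> * infdist w A"
proof -
  \<comment> \<open>The reverse inequality is this one applied to \<open>inverse s\<close> and
    \<open>s *\<^sub>R w\<close>.\<close>
  have le: "infdist (s *\<^sub>R w) A \<le> \<bar>s\<bar> * infdist w A" if "s \<noteq> 0" for s w
  proof -
    have "infdist (s *\<^sub>R w) A / \<bar>s\<bar> \<le> dist w a" if "a \<in> A" for a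
    proof -
      have "infdist (s *\<^sub>R w) A \<le> dist (s *\<^sub>R w) (s *\<^sub>R a)"
        using assms(1) that by (intro infdist_le) auto
      also have "\<dots> = \<bar>s\<bar> * dist w a"
        by (simp add: dist_norm flip: scaleR_diff_right)
      finally show ?thesis
        using \<open>s \<noteq> 0\<close> by (simp add: field_simps)
    qed
    then have "infdist (s *\<^sub>R w) A / \<bar>s\<bar> \<le> infdist w A"
      using assms(2) by (auto simp: infdist_def intro!: cINF_greatest)
    then show ?thesis
      using that by (simp add: field_simps)
  qed
  show ?thesis
  proof (cases "s = 0")
    case True
    have "0 \<in> A"
      using assms by (metis ex_in_conv scaleR_zero_left)
    with True show ?thesis by simp
  next
    case False
    then show ?thesis
      using le[of s w] le[of "inverse s" "s *\<^sub>R w"] by (simp add: field_simps)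
  qed
qed

text \<open>This is connectedness at infinity expressed without projective space. The hypothesis
  \<open>asymptotic\<close> says that \<open>A\<close> and \<open>B\<close> together contain every
  limit direction of \<open>f\<close>, while \<open>a\<close> and \<open>b\<close> witness that each
  of them contains one.\<close>

lemma cones_not_both_asymptotic:
  fixes f :: "'a::real_normed_vector \<Rightarrow> 'b::euclidean_space"
  assumes line: "\<And>x v. \<exists>c. \<forall>t. f (x + t *\<^sub>R v) = (\<Sum>j\<le>d. t ^ j *\<^sub>R c j)"
    and contf: "continuous_on UNIV f"
    and closed: "closed A" "closed B"
    and coneA: "\<And>s w. w \<in> A \<Longrightarrow> s *\<^sub>R w \<in> A" and coneB: "\<And>s w. w \<in> B \<Longrightarrow> s *\<^sub>R w \<in> B"
    and AB: "A \<inter> B = {0}"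
    and asymptotic: "\<And>s x w. s \<longlonglongrightarrow> 0 \<Longrightarrow> (\<lambda>k. s k *\<^sub>R f (x k)) \<longlonglongrightarrow> w \<Longrightarrow> w \<in> A \<union> B"
    and a: "s \<longlonglongrightarrow> 0" "(\<lambda>k. s k *\<^sub>R f (x k)) \<longlonglongrightarrow> a" "a \<in> A" "a \<noteq> 0"
    and b: "u \<longlonglongrightarrow> 0" "(\<lambda>k. u k *\<^sub>R f (y k)) \<longlonglongrightarrow> b" "b \<in> B" "b \<noteq> 0"
  shows False
proof -
  have ne: "A \<noteq> {}" "B \<noteq> {}" using a b by auto
  \<comment> \<open>\<open>D\<close> is negative on \<open>A\<close> and positive on
    \<open>B\<close> away from the origin. It is homogeneous of degree one in the absolute value of
    the scalar, so a vanishing sum of values of \<open>D\<close> still vanishes after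
    rescaling.\<close>
  define D where "D w = infdist w A - infdist w B" for w
  have D_scale: "D (s *\<^sub>R w) = \<bar>s\<bar> * D w" for s w
    unfolding D_def using infdist_cone[OF coneA ne(1)] infdist_cone[OF coneB ne(2)]
    by (simp add: algebra_simps)
  have contD: "continuous_on S D" for S
    unfolding D_def by (intro continuous_intros)
  have D_lim: "(\<lambda>k. D (h k)) \<longlonglongrightarrow> D l" if "h \<longlonglongrightarrow> l" for h l
    using contD[of UNIV] that by (metis continuous_on_tendsto_compose UNIV_I eventually_sequentiallyI)
  have D_A: "D w \<le> 0" "w \<noteq> 0 \<Longrightarrow> D w < 0" if "w \<in> A" for w
    using that AB in_closed_iff_infdist_zero[OF closed(2) ne(2), of w] infdist_nonneg[of w B]
    by (auto simp: D_def order_le_less)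
  have D_B: "D w \<ge> 0" "w \<noteq> 0 \<Longrightarrow> D w > 0" if "w \<in> B" for w
    using that AB in_closed_iff_infdist_zero[OF closed(1) ne(1), of w] infdist_nonneg[of w A]
    by (auto simp: D_def order_le_less)

  \<comment> \<open>\<open>P\<close> is the centre of the probe and \<open>Q\<close> its direction
    scaled by the radius. The radius vanishes at \<open>t = 0\<close> and \<open>t = 1\<close>, so
    there all sample points coincide with \<open>x k\<close> or \<open>y k\<close> and the sign of
    \<open>\<phi> k\<close> is that of \<open>D\<close> at one value of \<open>f\<close>.\<close>
  define P where "P k t = x k + t *\<^sub>R (y k - x k)" for k and t :: real
  define Q where "Q k t = (t * (1 - t)) *\<^sub>R (y k - x k)" for k and t :: real
  \<comment> \<open>There are \<open>d + 1\<close> sample points because a nonzero curve of degree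
    at most \<open>d\<close> cannot vanish at all of them.\<close>
  define \<phi> where "\<phi> k t = (\<Sum>i\<le>d. D (f (P k t + real i *\<^sub>R Q k t)))" for k t
  have "\<forall>\<^sub>F k in sequentially. D (s k *\<^sub>R f (x k)) < 0" "\<forall>\<^sub>F k in sequentially. D (u k *\<^sub>R f (y k)) > 0"
    using order_tendstoD[OF D_lim[OF a(2)]] order_tendstoD[OF D_lim[OF b(2)]] D_A D_B a b by blast+
  then have "\<forall>\<^sub>F k in sequentially. \<exists>t. 0 \<le> t \<and> t \<le> 1 \<and> \<phi> k t = 0"
  proof eventually_elim
    case (elim k)
    then have "D (f (x k)) < 0" "D (f (y k)) > 0"
      by (auto simp: D_scale mult_less_0_iff zero_less_mult_iff)
    then have "\<phi> k 0 \<le> 0" "\<phi> k 1 \<ge> 0"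
      by (auto simp: \<phi>_def P_def Q_def mult_nonneg_nonpos)
    moreover have "continuous_on {0..1} (\<phi> k)"
      unfolding \<phi>_def P_def Q_def
      by (intro continuous_intros continuous_on_compose2[OF contD[of UNIV]] continuous_on_compose2[OF contf]) auto
    ultimately show ?case
      using IVT'[of "\<phi> k" 0 0 1] by auto
  qed
  then have "\<exists>T. \<forall>\<^sub>F k in sequentially. 0 \<le> T k \<and> T k \<le> 1 \<and> \<phi> k (T k) = 0"
    unfolding eventually_ex .
  then obtain T where T: "\<forall>\<^sub>F k in sequentially. 0 \<le> T k \<and> T k \<le> 1 \<and> \<phi> k (T k) = 0" ..

  define p where "p k = P k (T k)" for k
  define q where "q k = Q k (T k)" for k
  have "\<forall>k. \<exists>c. \<forall>t. f (p k + t *\<^sub>R q k) = (\<Sum>j\<le>d. t ^ j *\<^sub>R c j)"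
    using line by blast
  from choice[OF this] obtain c where c: "\<And>k t. f (p k + t *\<^sub>R q k) = (\<Sum>j\<le>d. t ^ j *\<^sub>R c k j)"
    by blast
  \<comment> \<open>\<open>N k\<close> measures the size of the coefficients. The summand 1 in
    \<open>e k\<close> avoids division by zero and costs nothing in the limit, since
    \<open>e k\<close> is shown to tend to 0.\<close>
  define N where "N k = (\<Sum>j\<le>d. norm (c k j))" for k
  define e where "e k = 1 / (1 + N k)" for k
  have N0: "N k \<ge> 0" for k
    unfolding N_def by (simp add: sum_nonneg)
  have bound: "norm (f (p k + t *\<^sub>R q k)) \<le> 2 ^ d * N k" if "\<bar>t\<bar> \<le> 2" for k t
  proof -
    have "norm (t ^ j *\<^sub>R c k j) \<le> 2 ^ d * norm (c k j)" if "j \<le> d" for j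
    proof -
      have "\<bar>t\<bar> ^ j \<le> 2 ^ j"
        using \<open>\<bar>t\<bar> \<le> 2\<close> by (simp add: power_mono)
      also have "(2::real) ^ j \<le> 2 ^ d"
        using that by (simp add: power_increasing)
      finally show ?thesis
        by (simp add: power_abs mult_right_mono)
    qed
    then show ?thesis
      unfolding c N_def sum_distrib_left by (intro sum_norm_le) auto
  qed
  \<comment> \<open>Solving \<open>T k + t * (T k * (1 - T k)) = 0\<close> gives the parameter
    \<open>- (1 / (1 - T k))\<close> of \<open>x k\<close>, and the value 1 in place of 0 gives the
    parameter \<open>1 / T k\<close> of \<open>y k\<close>. The endpoint nearer to the centre has a
    parameter of absolute value at most 2, so \<open>bound\<close> applies to it.\<close>
  have endpoint: "norm (f (x k)) \<le> 2 ^ d * N k \<or> norm (f (y k)) \<le> 2 ^ d * N k"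
    if "0 \<le> T k" "T k \<le> 1" for k
  proof (cases "T k \<le> 1 / 2")
    case True
    let ?t = "- (1 / (1 - T k))"
    have "p k + ?t *\<^sub>R q k = x k + (T k + ?t * (T k * (1 - T k))) *\<^sub>R (y k - x k)"
      unfolding p_def q_def P_def Q_def by (simp only: scaleR_scaleR scaleR_add_left add.assoc)
    also have "T k + ?t * (T k * (1 - T k)) = 0"
      using True by simp
    finally show ?thesis
      using bound[of ?t k] True by (simp add: field_simps)
  next
    case False
    let ?t = "1 / T k"
    have "p k + ?t *\<^sub>R q k = x k + (T k + ?t * (T k * (1 - T k))) *\<^sub>R (y k - x k)"
      unfolding p_def q_def P_def Q_def by (simp only: scaleR_scaleR scaleR_add_left add.assoc)
    also have "T k + ?t * (T k * (1 - T k)) = 1"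
      using False by simp
    finally show ?thesis
      using bound[of ?t k] False by (simp add: field_simps)
  qed
  have e_lim: "e \<longlonglongrightarrow> 0"
  proof (rule tendsto_sandwich)
    show "\<forall>\<^sub>F k in sequentially. 0 \<le> e k"
      using N0 by (simp add: e_def)
    have "(\<lambda>k. norm (s k *\<^sub>R f (x k))) \<longlonglongrightarrow> norm a" "(\<lambda>k. norm (u k *\<^sub>R f (y k))) \<longlonglongrightarrow> norm b"
      by (intro tendsto_norm a b)+
    from order_tendstoD(1)[OF this(1), of "norm a / 2"] order_tendstoD(1)[OF this(2), of "norm b / 2"]
    have "\<forall>\<^sub>F k in sequentially. norm a / 2 < norm (s k *\<^sub>R f (x k))"
      "\<forall>\<^sub>F k in sequentially. norm b / 2 < norm (u k *\<^sub>R f (y k))"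
      using a(4) b(4) by simp_all
    \<comment> \<open>The value of \<open>f\<close> at the nearer endpoint has norm above
      \<open>norm a / (2 * \<bar>s k\<bar>)\<close> or
      \<open>norm b / (2 * \<bar>u k\<bar>)\<close>, which forces \<open>N k\<close> to be large.
      Which endpoint is nearer may vary with \<open>k\<close>, hence the sum of both bounds.\<close>
    then show "\<forall>\<^sub>F k in sequentially. e k \<le> 2 ^ d * (2 * \<bar>s k\<bar> / norm a + 2 * \<bar>u k\<bar> / norm b)"
      using T
    proof eventually_elim
      case (elim k)
      have step: "e k \<le> 2 ^ d * (2 * \<bar>r\<bar> / n)" if "n > 0" "n / 2 < \<bar>r\<bar> * m" "m \<le> 2 ^ d * N k" for r n m :: real
      proof -
        have "n / 2 < \<bar>r\<bar> * (2 ^ d * N k)"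
          using that by (meson abs_ge_zero less_le_trans mult_left_mono)
        also have "\<dots> \<le> \<bar>r\<bar> * (2 ^ d * (1 + N k))"
          by (intro mult_left_mono) auto
        finally show ?thesis
          using \<open>n > 0\<close> N0[of k] unfolding e_def by (simp add: field_simps)
      qed
      have nonneg: "0 \<le> 2 ^ d * (2 * \<bar>s k\<bar> / norm a)" "0 \<le> 2 ^ d * (2 * \<bar>u k\<bar> / norm b)"
        by simp_all
      have "e k \<le> 2 ^ d * (2 * \<bar>s k\<bar> / norm a) \<or> e k \<le> 2 ^ d * (2 * \<bar>u k\<bar> / norm b)"
        using endpoint[of k] elim step[of "norm a" "s k" "norm (f (x k))"]
          step[of "norm b" "u k" "norm (f (y k))"] a(4) b(4) by auto
      then show ?case
        unfolding distrib_left using nonneg by linarith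
    qed
    have "(\<lambda>k. 2 ^ d * (2 * \<bar>s k\<bar> / norm a + 2 * \<bar>u k\<bar> / norm b)) \<longlonglongrightarrow> 2 ^ d * (2 * \<bar>0\<bar> / norm a + 2 * \<bar>0\<bar> / norm b)"
      by (intro tendsto_intros a b) (use a b in auto)
    then show "(\<lambda>k. 2 ^ d * (2 * \<bar>s k\<bar> / norm a + 2 * \<bar>u k\<bar> / norm b)) \<longlonglongrightarrow> 0"
      by simp
  qed simp

  have "norm (e k *\<^sub>R c k j) \<le> 1" if "j < Suc d" for j k
  proof -
    have "norm (c k j) \<le> N k"
      unfolding N_def using that by (intro member_le_sum) auto
    then show ?thesis
      unfolding e_def using N0[of k] by (simp add: field_simps)
  qed
  then have "bounded (range (\<lambda>k. e k *\<^sub>R c k j))" if "j < Suc d" for j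
    using that by (auto simp: bounded_iff)
  then obtain r L where r: "strict_mono r"
    and L: "\<And>j. j < Suc d \<Longrightarrow> (\<lambda>k. e (r k) *\<^sub>R c (r k) j) \<longlonglongrightarrow> L j"
    using finite_family_convergent_subsequence[of "Suc d" "\<lambda>k j. e k *\<^sub>R c k j"] by blast
  have er: "(\<lambda>k. e (r k)) \<longlonglongrightarrow> 0"
    using LIMSEQ_subseq_LIMSEQ[OF e_lim r] by (simp add: o_def)
  \<comment> \<open>The norms of the normalized coefficients add up to \<open>1 - e k\<close>, which
    tends to 1, so the limits cannot all vanish.\<close>
  have nz: "\<exists>j\<le>d. L j \<noteq> 0"
  proof (rule ccontr)
    assume L0: "\<not> ?thesis"
    have "(\<lambda>k. \<Sum>j\<le>d. norm (e (r k) *\<^sub>R c (r k) j)) \<longlonglongrightarrow> (\<Sum>j\<le>d. norm (L j))"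
      by (intro tendsto_sum tendsto_norm L) auto
    moreover have "(\<Sum>j\<le>d. norm (e k *\<^sub>R c k j)) = 1 - e k" for k
    proof -
      have "(\<Sum>j\<le>d. norm (e k *\<^sub>R c k j)) = e k * N k"
        using N0[of k] by (simp add: N_def sum_distrib_left e_def)
      also have "\<dots> = 1 - e k"
        using N0[of k] by (simp add: e_def field_simps)
      finally show ?thesis .
    qed
    ultimately have "(\<lambda>k. 1 - e (r k)) \<longlonglongrightarrow> 0"
      using L0 by simp
    moreover have "(\<lambda>k. 1 - e (r k)) \<longlonglongrightarrow> 1 - 0"
      by (intro tendsto_intros er)
    ultimately show False
      using LIMSEQ_unique by fastforce
  qed
  define G where "G t = (\<Sum>j\<le>d. t ^ j *\<^sub>R L j)" for t :: real
  have G: "(\<lambda>k. e (r k) *\<^sub>R f (p (r k) + t *\<^sub>R q (r k))) \<longlonglongrightarrow> G t" for t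
  proof -
    have "(\<lambda>k. \<Sum>j\<le>d. t ^ j *\<^sub>R (e (r k) *\<^sub>R c (r k) j)) \<longlonglongrightarrow> G t"
      unfolding G_def by (intro tendsto_intros L) auto
    then show ?thesis
      unfolding c scaleR_sum_right by (simp add: mult.commute)
  qed
  have "G t \<in> A \<union> B" for t
    by (rule asymptotic[OF er G])
  then have dich: "(\<forall>t. G t \<in> A) \<or> (\<forall>t. G t \<in> B)"
    unfolding G_def using polynomial_curve_in_one_cone[OF closed coneA coneB AB nz] by blast

  have "(\<lambda>k. \<Sum>i\<le>d. D (e (r k) *\<^sub>R f (p (r k) + real i *\<^sub>R q (r k)))) \<longlonglongrightarrow> (\<Sum>i\<le>d. D (G (real i)))"
    by (intro tendsto_sum D_lim G)
  moreover have "(\<Sum>i\<le>d. D (e k *\<^sub>R f (p k + real i *\<^sub>R q k))) = \<bar>e k\<bar> * \<phi> k (T k)" for k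
    by (simp add: D_scale \<phi>_def p_def q_def sum_distrib_left)
  ultimately have "(\<lambda>k. \<bar>e (r k)\<bar> * \<phi> (r k) (T (r k))) \<longlonglongrightarrow> (\<Sum>i\<le>d. D (G (real i)))"
    by simp
  moreover have "\<forall>\<^sub>F k in sequentially. \<bar>e (r k)\<bar> * \<phi> (r k) (T (r k)) = 0"
    using eventually_subseq[OF r T] by (auto elim: eventually_mono)
  then have "(\<lambda>k. \<bar>e (r k)\<bar> * \<phi> (r k) (T (r k))) \<longlonglongrightarrow> 0"
    by (rule tendsto_eventually)
  ultimately have zero: "(\<Sum>i\<le>d. D (G (real i))) = 0"
    by (rule LIMSEQ_unique)
  \<comment> \<open>A nonzero curve has at most \<open>d\<close> roots, fewer than the
    \<open>d + 1\<close> sample points. At the index found, \<open>D\<close> has a strict sign,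
    while by \<open>dich\<close> no other term has the opposite sign.\<close>
  obtain i where i: "i \<le> d" "G (real i) \<noteq> 0"
  proof (rule ccontr)
    assume "\<not> thesis"
    then have "real ` {..d} \<subseteq> {t. G t = 0}"
      using that by blast
    moreover have "finite {t. G t = 0}" "card {t. G t = 0} \<le> d"
      using vector_polynomial_root_bound[OF nz] unfolding G_def by auto
    ultimately have "card (real ` {..d}) \<le> d"
      by (meson card_mono order_trans)
    then show False
      by (simp add: card_image)
  qed
  from dich show False
  proof
    assume *: "\<forall>t. G t \<in> A"
    have "(\<Sum>i\<le>d. D (G (real i))) < (\<Sum>i\<le>d. 0)"
      by (rule sum_strict_mono_ex1) (use * D_A i in auto)
    with zero show False by simp
  next
    assume *: "\<forall>t. G t \<in> B"
    have "(\<Sum>i\<le>d. 0) < (\<Sum>i\<le>d. D (G (real i)))"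
      by (rule sum_strict_mono_ex1) (use * D_B i in auto)
    with zero show False by simp
  qed
qed

section \<open>Topology of projective space and points at infinity as limits\<close>

lemma hom_coords_scaleR:
  assumes "c \<noteq> 0" "v \<noteq> 0"
  shows "hom_coords (c *\<^sub>R v) = hom_coords v"
  using assms by (subst hom_coords_eq_iff) (auto intro!: exI[of _ "inverse c"])

text \<open>The saturation of \<open>V\<close> is the union of its nonzero multiples, each of which
  is open.\<close>

lemma open_map_hom_coords:
  fixes V :: "(real \<times> (real ^ 'm)) set"
  assumes "open V" "0 \<notin> V"
  shows "open (hom_coords ` V)"
proof -
  have "{v. v \<noteq> 0 \<and> hom_coords v \<in> hom_coords ` V} = (\<Union>c\<in>- {0}. (\<lambda>v. c *\<^sub>R v) ` V)" (is "?L = ?R")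
  proof
    show "?L \<subseteq> ?R"
    proof clarify
      fix v u :: "real \<times> (real ^ 'm)" assume v: "v \<noteq> 0" "hom_coords v = hom_coords u" "u \<in> V"
      then have "u \<noteq> 0" using assms by auto
      with v obtain c where "c \<noteq> 0" "v = c *\<^sub>R u"
        using hom_coords_eq_iff[of u v] by metis
      with v show "v \<in> ?R" by auto
    qed
    show "?R \<subseteq> ?L"
    proof
      fix u assume "u \<in> ?R"
      then obtain c v where u: "c \<noteq> 0" "v \<in> V" "u = c *\<^sub>R v" by blast
      then have "v \<noteq> 0" using assms by auto
      with u show "u \<in> ?L"
        by (simp add: hom_coords_scaleR)
    qed
  qed
  moreover have "open ?R"
    using assms by (intro open_UN ballI open_scaling) auto
  ultimately show ?thesis
    unfolding open_real_proj_def by simp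
qed

text \<open>For a continuous open map, taking preimages commutes with closure. This moves closures
  into a Euclidean space, where sequences are available.\<close>

lemma hom_coords_in_closure_iff:
  fixes v :: "real \<times> (real ^ 'm)"
  assumes "v \<noteq> 0"
  shows "hom_coords v \<in> closure X \<longleftrightarrow> v \<in> closure {u. u \<noteq> 0 \<and> hom_coords u \<in> X}"
proof
  assume v: "hom_coords v \<in> closure X"
  show "v \<in> closure {u. u \<noteq> 0 \<and> hom_coords u \<in> X}"
    unfolding closure_iff_nhds_not_empty
  proof (intro allI impI)
    fix N V assume V: "V \<subseteq> N" "open V" "v \<in> V"
    have "open (hom_coords ` (V - {0}))"
      using V by (intro open_map_hom_coords open_Diff) auto
    then have "X \<inter> hom_coords ` (V - {0}) \<noteq> {}"
      using v V assms unfolding closure_iff_nhds_not_empty by blast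
    then show "{u. u \<noteq> 0 \<and> hom_coords u \<in> X} \<inter> N \<noteq> {}"
      using V by blast
  qed
next
  assume v: "v \<in> closure {u. u \<noteq> 0 \<and> hom_coords u \<in> X}"
  show "hom_coords v \<in> closure X"
    unfolding closure_iff_nhds_not_empty
  proof (intro allI impI)
    fix N V assume V: "V \<subseteq> N" "open V" "hom_coords v \<in> V"
    have "{u. u \<noteq> 0 \<and> hom_coords u \<in> X} \<inter> {u. u \<noteq> 0 \<and> hom_coords u \<in> V} \<noteq> {}"
      using v V assms unfolding closure_iff_nhds_not_empty open_real_proj_def by blast
    then show "X \<inter> N \<noteq> {}"
      using V by blast
  qed
qed

lemma preimage_affine_embed:
  "{u. u \<noteq> 0 \<and> hom_coords u \<in> affine_embed ` S} = {c *\<^sub>R (1, y) |c y. c \<noteq> 0 \<and> y \<in> S}"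
proof -
  have ne: "(1::real, y :: real ^ 'a) \<noteq> 0" for y
    by (simp add: zero_prod_def)
  show ?thesis
  proof (intro set_eqI iffI)
    fix u :: "real \<times> (real ^ 'a)" assume "u \<in> {u. u \<noteq> 0 \<and> hom_coords u \<in> affine_embed ` S}"
    then obtain y where y: "u \<noteq> 0" "y \<in> S" "hom_coords (1, y) = hom_coords u"
      unfolding affine_embed_def by auto
    then show "u \<in> {c *\<^sub>R (1, y) |c y. c \<noteq> 0 \<and> y \<in> S}"
      using hom_coords_eq_iff[OF ne y(1)] by blast
  next
    fix u :: "real \<times> (real ^ 'a)" assume "u \<in> {c *\<^sub>R (1, y) |c y. c \<noteq> 0 \<and> y \<in> S}"
    then obtain c y where "u = c *\<^sub>R (1, y)" "c \<noteq> 0" "y \<in> S" by blast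
    then show "u \<in> {u. u \<noteq> 0 \<and> hom_coords u \<in> affine_embed ` S}"
      using ne[of y] hom_coords_scaleR[OF _ ne, of c y] by (simp add: affine_embed_def del: scaleR_Pair)
  qed
qed

text \<open>The nonzero representatives of affine points of the image are the vectors
  \<open>(s, s *\<^sub>R f x)\<close> with \<open>s\<close> nonzero; a point at infinity is a limit
  of these whose first coordinate is 0.\<close>

lemma hom_coords_in_points_at_infinity_iff:
  fixes w :: "real ^ 'm"
  assumes "w \<noteq> 0"
  shows "hom_coords (0, w) \<in> points_at_infinity (range f) \<longleftrightarrow>
    (\<exists>s x. s \<longlonglongrightarrow> 0 \<and> (\<lambda>k. s k *\<^sub>R f (x k)) \<longlonglongrightarrow> w)" (is "?L \<longleftrightarrow> ?R")
proof -
  have ne: "(0::real, w) \<noteq> 0"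
    using assms by (simp add: zero_prod_def)
  have eq: "?L \<longleftrightarrow> (0 :: real, w) \<in> closure {c *\<^sub>R (1, y) |c y. c \<noteq> 0 \<and> y \<in> range f}"
  proof -
    have "hom_coords (0, w) \<in> hyperplane_at_infinity"
      using assms unfolding hyperplane_at_infinity_def by blast
    then show ?thesis
      unfolding points_at_infinity_def preimage_affine_embed[symmetric]
      using hom_coords_in_closure_iff[OF ne] by blast
  qed
  show ?thesis
  proof
    assume ?L
    then obtain z :: "nat \<Rightarrow> real \<times> (real ^ 'm)"
      where z: "\<And>k. z k \<in> {c *\<^sub>R (1, y) |c y. c \<noteq> 0 \<and> y \<in> range f}" "z \<longlonglongrightarrow> (0, w)"
      unfolding eq closure_sequential by blast
    have "\<exists>c x. z k = (c, c *\<^sub>R f x)" for k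
    proof -
      obtain c x where "z k = c *\<^sub>R (1, f x)"
        using z(1)[of k] by blast
      then show ?thesis by auto
    qed
    then obtain s x where sx: "\<And>k. z k = (s k, s k *\<^sub>R f (x k))"
      by metis
    show ?R
      using tendsto_fst[OF z(2)] tendsto_snd[OF z(2)] unfolding sx fst_conv snd_conv by blast
  next
    assume ?R
    then obtain s x where sx: "s \<longlonglongrightarrow> 0" "(\<lambda>k. s k *\<^sub>R f (x k)) \<longlonglongrightarrow> w" by blast
    \<comment> \<open>The scalars \<open>s k\<close> may be zero for some \<open>k\<close>, but a
      nonzero limit \<open>w\<close> excludes this eventually.\<close>
    have "\<forall>\<^sub>F k in sequentially. s k *\<^sub>R f (x k) \<noteq> 0"
      using sx(2) assms by (rule tendsto_imp_eventually_ne)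
    then have "\<forall>\<^sub>F k in sequentially. (s k, s k *\<^sub>R f (x k)) \<in>
        closure {c *\<^sub>R (1, y) |c y. c \<noteq> 0 \<and> y \<in> range f}"
      by eventually_elim (rule subsetD[OF closure_subset], auto)
    then show ?L
      unfolding eq
      by (rule Lim_in_closed_set[OF closed_closure]) (auto intro!: tendsto_Pair sx)
  qed
qed

text \<open>Because of this, a disconnection may be taken to consist of two sets closed in the whole
  projective space, so that their cones are closed as well.\<close>

lemma closed_points_at_infinity: "closed (points_at_infinity S)"
proof -
  have "open (- (hyperplane_at_infinity :: 'a real_proj set))"
  proof -
    have "{v. v \<noteq> 0 \<and> hom_coords v \<in> - (hyperplane_at_infinity :: 'a real_proj set)} = - {v. fst v = 0}"
    proof (intro set_eqI iffI)
      fix v :: "real \<times> (real ^ 'a)" assume "v \<in> {v. v \<noteq> 0 \<and> hom_coords v \<in> - hyperplane_at_infinity}"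
      then show "v \<in> - {v. fst v = 0}"
        by (cases v) (auto simp: hyperplane_at_infinity_def zero_prod_def)
    next
      fix v :: "real \<times> (real ^ 'a)" assume v: "v \<in> - {v. fst v = 0}"
      then have "v \<noteq> 0" by auto
      moreover have "hom_coords v \<noteq> hom_coords (0, y)" if "y \<noteq> 0" for y
      proof
        assume "hom_coords v = hom_coords (0, y)"
        moreover have "(0::real, y) \<noteq> 0"
          using that by (simp add: zero_prod_def)
        ultimately obtain c where "c \<noteq> 0" "(0, y) = c *\<^sub>R v"
          using hom_coords_eq_iff[OF \<open>v \<noteq> 0\<close>] by metis
        then show False
          using v by (cases v) auto
      qed
      ultimately show "v \<in> {v. v \<noteq> 0 \<and> hom_coords v \<in> - hyperplane_at_infinity}"
        by (auto simp: hyperplane_at_infinity_def)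
    qed
    moreover have "closed {v :: real \<times> (real ^ 'a). fst v = 0}"
      by (intro closed_Collect_eq continuous_intros)
    ultimately show ?thesis
      unfolding open_real_proj_def by (simp add: open_Compl)
  qed
  then show ?thesis
    unfolding points_at_infinity_def by (intro closed_Int closed_closure) (simp add: closed_def)
qed

lemma closed_cone_at_infinity:
  fixes X :: "'m::finite real_proj set"
  assumes "closed X"
  shows "closed {w. w = 0 \<or> hom_coords (0, w) \<in> X}"
proof -
  have "open {v. v \<noteq> 0 \<and> hom_coords v \<in> - X}"
    using assms unfolding closed_def open_real_proj_def .
  then have "open ((\<lambda>w. (0, w)) -` {v. v \<noteq> 0 \<and> hom_coords v \<in> - X})"
    by (intro open_vimage continuous_intros)
  moreover have "(\<lambda>w. (0, w)) -` {v. v \<noteq> 0 \<and> hom_coords v \<in> - X} = - {w. w = 0 \<or> hom_coords (0, w) \<in> X}"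
    by (auto simp: zero_prod_def)
  ultimately show ?thesis
    by (simp add: closed_def)
qed

section \<open>Existence of a point at infinity, and the conclusion\<close>

lemma nonconstant_polynomial_map_asymptotic:
  fixes f :: "'a::real_normed_vector \<Rightarrow> real ^ 'm"
  assumes line: "\<And>x v. \<exists>c. \<forall>t. f (x + t *\<^sub>R v) = (\<Sum>j\<le>d. t ^ j *\<^sub>R c j)"
    and "\<not> f constant_on UNIV"
  shows "\<exists>s x w. w \<noteq> 0 \<and> s \<longlonglongrightarrow> 0 \<and> (\<lambda>k. s k *\<^sub>R f (x k)) \<longlonglongrightarrow> w"
proof -
  obtain x y where xy: "f x \<noteq> f y"
    using assms(2) unfolding constant_on_def by blast
  obtain c where c: "\<And>t. f (x + t *\<^sub>R (y - x)) = (\<Sum>j\<le>d. t ^ j *\<^sub>R c j)"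
    using line by blast
  have "\<exists>k. k \<noteq> 0 \<and> k \<le> d \<and> c k \<noteq> 0"
  proof (rule ccontr)
    assume "\<not> ?thesis"
    \<comment> \<open>Since \<open>0 ^ 0 = 1\<close>, replacing \<open>t\<close> by 0 keeps the
      constant term, and the other terms vanish by assumption.\<close>
    then have "t ^ j *\<^sub>R c j = 0 ^ j *\<^sub>R c j" if "j \<le> d" for t :: real and j
      using that by (cases j) auto
    then have "f (x + t *\<^sub>R (y - x)) = (\<Sum>j\<le>d. 0 ^ j *\<^sub>R c j)" for t
      unfolding c by (intro sum.cong) auto
    from this[of 0] this[of 1] xy show False by simp
  qed
  then obtain k i where k: "k \<noteq> 0" "k \<le> d" "c k $ i \<noteq> 0"
    by (metis vec_eq_iff zero_index)
  have "\<exists>z. norm (f z) \<ge> real n" for n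
  proof -
    have "\<forall>\<^sub>F t::real in at_infinity. norm (\<Sum>j\<le>d. (c j $ i) * t ^ j) \<ge> real n"
      using k by (intro polyfun_extremal) auto
    then obtain t :: real where t: "norm (\<Sum>j\<le>d. (c j $ i) * t ^ j) \<ge> real n"
      unfolding eventually_at_infinity by (metis abs_ge_self real_norm_def)
    have "(\<Sum>j\<le>d. (c j $ i) * t ^ j) = f (x + t *\<^sub>R (y - x)) $ i"
      unfolding c by (simp add: mult.commute)
    with t component_le_norm_cart[of "f (x + t *\<^sub>R (y - x))" i] show ?thesis
      by (metis order_trans real_norm_def)
  qed
  then obtain z where z: "\<And>n. norm (f (z n)) \<ge> real n"
    by metis
  \<comment> \<open>The shift to \<open>Suc n\<close> keeps the norm positive. The rescaled values
    then lie on the unit sphere, whose compactness provides a nonzero limit direction.\<close>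
  define s where "s n = inverse (norm (f (z (Suc n))))" for n
  have s_lim: "s \<longlonglongrightarrow> 0"
  proof (rule tendsto_sandwich)
    show "\<forall>\<^sub>F n in sequentially. 0 \<le> s n"
      by (simp add: s_def)
    show "\<forall>\<^sub>F n in sequentially. s n \<le> inverse (real (Suc n))"
      unfolding s_def by (intro always_eventually allI le_imp_inverse_le z) simp
    show "(\<lambda>n. inverse (real (Suc n))) \<longlonglongrightarrow> 0"
      by (rule LIMSEQ_inverse_real_of_nat)
  qed simp
  have pos: "norm (f (z (Suc n))) > 0" for n
    using z[of "Suc n"] by linarith
  have "s n *\<^sub>R f (z (Suc n)) \<in> sphere 0 1" for n
    using pos[of n] by (simp add: s_def)
  then obtain w r where w: "w \<in> sphere 0 1" "strict_mono (r :: nat \<Rightarrow> nat)"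
      "((\<lambda>n. s n *\<^sub>R f (z (Suc n))) \<circ> r) \<longlonglongrightarrow> w"
    using compact_sphere[of 0 1] unfolding compact_def by meson
  then show ?thesis
    using LIMSEQ_subseq_LIMSEQ[OF s_lim w(2)]
    by (intro exI[of _ "s \<circ> r"] exI[of _ "\<lambda>k. z (Suc (r k))"] exI[of _ w]) (auto simp: o_def)
qed

theorem theorem1p1:
  fixes f :: "real ^ 'n \<Rightarrow> real ^ 'm"
  assumes "polynomial_map f"
    and "\<not> f constant_on UNIV"
  shows "points_at_infinity (range f) \<noteq> {} \<and> connected (points_at_infinity (range f))"
proof
  obtain d where line: "\<And>x v. \<exists>c. \<forall>t. f (x + t *\<^sub>R v) = (\<Sum>j\<le>d. t ^ j *\<^sub>R c j)"
    using polynomial_map_on_line[OF assms(1)] by blast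
  have "continuous_on UNIV (\<lambda>x. \<chi> i. f x $ i)"
    using assms(1) unfolding polynomial_map_def
    by (intro continuous_on_vec_lambda continuous_at_imp_continuous_on) (auto intro: continuous_real_polymonial_function)
  then have contf: "continuous_on UNIV f"
    by simp
  show "points_at_infinity (range f) \<noteq> {}"
    using nonconstant_polynomial_map_asymptotic[OF line assms(2)] hom_coords_in_points_at_infinity_iff by blast
  show "connected (points_at_infinity (range f))"
  proof (rule ccontr)
    assume "\<not> connected (points_at_infinity (range f))"
    then obtain A B where "A \<noteq> {}" "B \<noteq> {}" and AB: "closed A" "closed B"
        "A \<union> B = points_at_infinity (range f)" "A \<inter> B = {}"
      unfolding connected_closed_set[OF closed_points_at_infinity] by blast
    \<comment> \<open>The origin is adjoined to make the cones closed and to have them meet exactly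
      in \<open>{0}\<close>.\<close>
    define cone where "cone X = {w. w = 0 \<or> hom_coords (0, w) \<in> X}" for X :: "'m real_proj set"
    have cone: "t *\<^sub>R w \<in> cone X" if "w \<in> cone X" for t w X
    proof (cases "t = 0 \<or> w = 0")
      case False
      then have "hom_coords (0, t *\<^sub>R w) = hom_coords (0, w)"
        using hom_coords_scaleR[of t "(0, w)"] by (simp add: zero_prod_def)
      with that False show ?thesis
        by (simp add: cone_def)
    qed (auto simp: cone_def)
    have point: "\<exists>s x w. s \<longlonglongrightarrow> 0 \<and> (\<lambda>k. s k *\<^sub>R f (x k)) \<longlonglongrightarrow> w \<and> w \<in> cone X \<and> w \<noteq> 0"
      if X: "X \<subseteq> points_at_infinity (range f)" "X \<noteq> {}" for X
    proof -
      obtain w where w: "w \<noteq> 0" "hom_coords (0, w) \<in> X"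
        using X unfolding points_at_infinity_def hyperplane_at_infinity_def by blast
      with X hom_coords_in_points_at_infinity_iff[OF w(1), of f] show ?thesis
        unfolding cone_def by blast
    qed
    obtain s x a where a: "s \<longlonglongrightarrow> 0" "(\<lambda>k. s k *\<^sub>R f (x k)) \<longlonglongrightarrow> a" "a \<in> cone A" "a \<noteq> 0"
      using point[of A] AB \<open>A \<noteq> {}\<close> by blast
    obtain u y b where b: "u \<longlonglongrightarrow> 0" "(\<lambda>k. u k *\<^sub>R f (y k)) \<longlonglongrightarrow> b" "b \<in> cone B" "b \<noteq> 0"
      using point[of B] AB \<open>B \<noteq> {}\<close> by blast
    have "cone A \<inter> cone B = {0}"
      using AB unfolding cone_def by auto
    moreover have "w \<in> cone A \<union> cone B"
      if "s \<longlonglongrightarrow> 0" "(\<lambda>k. s k *\<^sub>R f (x k)) \<longlonglongrightarrow> w" for s x w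
    proof (cases "w = 0")
      case False
      then have "hom_coords (0, w) \<in> A \<union> B"
        using that hom_coords_in_points_at_infinity_iff[of w f] AB by blast
      then show ?thesis by (auto simp: cone_def)
    qed (simp add: cone_def)
    moreover have "closed (cone A)" "closed (cone B)"
      unfolding cone_def by (intro closed_cone_at_infinity AB)+
    ultimately show False
      using cones_not_both_asymptotic[OF line contf _ _ cone cone _ _ a b] by blast
  qed
qed

end
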